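(* Let $X$ be a $T_0$-space. If the Smyth power space $P_S(X)$ is an $R$-space, then $X$ is a strong $R$-space, and hence $X$ is an $R$-space.
   Context: For a $T_0$-space $X$: the specialization order is $x\le_X y\iff x\in\overline{\{y\}}$, and $\uparrow\! A$ is the upper set generated by $A$ in this order; a subset is saturated if it equals the intersection of all open sets containing it (equivalently, it is an upper set); $Q(X)$ is the set of all nonempty compact saturated subsets of $X$ (compactness is the open-cover property). The Smyth power space $P_S(X)$ is the set $Q(X)$ with the upper Vietoris topology, i.e. the topology with base $\{\Box U: U \text{ open in } X\}$, where $\Box U=\{K\in Q(X): K\subseteq U\}$ (its specialization order is reverse inclusion). A $T_0$-space $X$ is an $R$-space if for every nonempty family $\{\uparrow\! F_i: i\in I\}$ with each $F_i\subseteq X$ nonempty finite and every open $U$, $\bigcap_{i\in I}\uparrow\! F_i\subseteq U$ implies $\bigcap_{i\in J}\uparrow\! F_i\subseteq U$ for some nonempty finite $J\subseteq I$. A $T_0$-space $X$ is a strong $R$-space if for every nonempty family $\{K_i: i\in I\}\subseteq Q(X)$ and every open $U\subseteq X$, $\bigcap_{i\in I}K_i\subseteq U$ implies $\bigcap_{i\in J}K_i\subseteq U$ for some nonempty finite $J\subseteq I$. *)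

theory Defs
  imports "HOL-Analysis.Analysis"
begin

definition spec_le :: "'a topology \<Rightarrow> 'a \<Rightarrow> 'a \<Rightarrow> bool" where
  "spec_le X x y \<longleftrightarrow> x \<in> topspace X \<and> y \<in> topspace X \<and> x \<in> X closure_of {y}"

definition up_set :: "'a topology \<Rightarrow> 'a set \<Rightarrow> 'a set" where
  "up_set X A = {y \<in> topspace X. \<exists>x\<in>A. spec_le X x y}"

definition saturatedin :: "'a topology \<Rightarrow> 'a set \<Rightarrow> bool" where
  "saturatedin X S \<longleftrightarrow> S \<subseteq> topspace X \<and> S = \<Inter>{U. openin X U \<and> S \<subseteq> U}"

definition compact_saturated_sets :: "'a topology \<Rightarrow> 'a set set" where
  "compact_saturated_sets X = {K. K \<noteq> {} \<and> compactin X K \<and> saturatedin X K}"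

definition smyth_box :: "'a topology \<Rightarrow> 'a set \<Rightarrow> 'a set set" where
  "smyth_box X U = {K \<in> compact_saturated_sets X. K \<subseteq> U}"

definition smyth_power :: "'a topology \<Rightarrow> 'a set topology" where
  "smyth_power X = topology (arbitrary union_of (\<lambda>B. \<exists>U. openin X U \<and> B = smyth_box X U))"

(* In the next two definitions a family is represented by its set of members; the finite
   index sets J become finite nonempty subfamilies. *)

definition R_space :: "'a topology \<Rightarrow> bool" where
  "R_space X \<longleftrightarrow> t0_space X \<and>
     (\<forall>\<F> U. \<F> \<noteq> {} \<and> (\<forall>F\<in>\<F>. F \<noteq> {} \<and> finite F \<and> F \<subseteq> topspace X) \<and> openin X U \<and>
        (\<Inter>F\<in>\<F>. up_set X F) \<subseteq> U \<longrightarrow>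
        (\<exists>\<G>. \<G> \<subseteq> \<F> \<and> finite \<G> \<and> \<G> \<noteq> {} \<and> (\<Inter>F\<in>\<G>. up_set X F) \<subseteq> U))"

definition strong_R_space :: "'a topology \<Rightarrow> bool" where
  "strong_R_space X \<longleftrightarrow> t0_space X \<and>
     (\<forall>\<K> U. \<K> \<noteq> {} \<and> \<K> \<subseteq> compact_saturated_sets X \<and> openin X U \<and> \<Inter>\<K> \<subseteq> U \<longrightarrow>
        (\<exists>\<J>. \<J> \<subseteq> \<K> \<and> finite \<J> \<and> \<J> \<noteq> {} \<and> \<Inter>\<J> \<subseteq> U))"

lemma openin_smyth_power:
  "openin (smyth_power X) = arbitrary union_of (\<lambda>B. \<exists>U. openin X U \<and> B = smyth_box X U)"
proof -
  have "istopology (arbitrary union_of (\<lambda>B. \<exists>U. openin X U \<and> B = smyth_box X U))"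
  proof (rule istopology_base)
    fix S T
    assume "\<exists>U. openin X U \<and> S = smyth_box X U" "\<exists>U. openin X U \<and> T = smyth_box X U"
    then obtain U V where "openin X U" "S = smyth_box X U" "openin X V" "T = smyth_box X V"
      by blast
    then show "\<exists>W. openin X W \<and> S \<inter> T = smyth_box X W"
      by (intro exI[of _ "U \<inter> V"]) (auto simp: smyth_box_def)
  qed
  then show ?thesis
    by (simp add: smyth_power_def)
qed

lemma openin_smyth_box: "openin X U \<Longrightarrow> openin (smyth_power X) (smyth_box X U)"
  by (auto simp: openin_smyth_power intro!: arbitrary_union_of_inc)

lemma topspace_smyth_power: "topspace (smyth_power X) = compact_saturated_sets X"
proof
  show "topspace (smyth_power X) \<subseteq> compact_saturated_sets X"
    unfolding topspace_def
    by (auto simp: openin_smyth_power union_of_def smyth_box_def)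
  have "smyth_box X (topspace X) = compact_saturated_sets X"
    by (auto simp: smyth_box_def compact_saturated_sets_def saturatedin_def)
  then show "compact_saturated_sets X \<subseteq> topspace (smyth_power X)"
    by (metis openin_smyth_box openin_subset openin_topspace)
qed

lemma spec_le_smyth_power:
  "spec_le (smyth_power X) K L \<longleftrightarrow>
     K \<in> compact_saturated_sets X \<and> L \<in> compact_saturated_sets X \<and> L \<subseteq> K"
proof (cases "K \<in> compact_saturated_sets X \<and> L \<in> compact_saturated_sets X")
  case True
  have "K \<in> smyth_power X closure_of {L} \<longleftrightarrow> L \<subseteq> K"
  proof
    assume cl: "K \<in> smyth_power X closure_of {L}"
    have "L \<subseteq> U" if "openin X U" "K \<subseteq> U" for U
    proof -
      have "K \<in> smyth_box X U"
        using that True by (simp add: smyth_box_def)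
      then have "L \<in> smyth_box X U"
        using cl openin_smyth_box[OF that(1)] unfolding in_closure_of by blast
      then show ?thesis
        by (simp add: smyth_box_def)
    qed
    then have "L \<subseteq> \<Inter>{U. openin X U \<and> K \<subseteq> U}"
      by blast
    moreover have "K = \<Inter>{U. openin X U \<and> K \<subseteq> U}"
      using True unfolding compact_saturated_sets_def saturatedin_def by blast
    ultimately show "L \<subseteq> K"
      by (rule ssubst[rotated])
  next
    assume "L \<subseteq> K"
    have "L \<in> T" if T: "openin (smyth_power X) T" "K \<in> T" for T
    proof -
      obtain \<U> where "\<U> \<subseteq> Collect (\<lambda>B. \<exists>U. openin X U \<and> B = smyth_box X U)" "\<Union>\<U> = T"
        using T(1) unfolding openin_smyth_power union_of_def by blast
      then obtain U where "K \<in> smyth_box X U" "smyth_box X U \<subseteq> T"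
        using T(2) by blast
      then show ?thesis
        using \<open>L \<subseteq> K\<close> True unfolding smyth_box_def by blast
    qed
    then show "K \<in> smyth_power X closure_of {L}"
      using True by (auto simp: in_closure_of topspace_smyth_power)
  qed
  then show ?thesis
    using True by (simp add: spec_le_def topspace_smyth_power)
qed (auto simp: spec_le_def topspace_smyth_power)

end

theory Submission
  imports Defs
begin

text \<open>Feeding the singletons \<open>{K}\<close> to the R-space property of the Smyth power space yields a finite
  subfamily \<open>\<J>\<close> such that every compact saturated \<open>L \<subseteq> \<Inter>\<J>\<close> lies in \<open>U\<close>. A point
  of \<open>\<Inter>\<J>\<close> is then caught by taking for \<open>L\<close> its principal upper set. Since upper sets of nonempty
  finite sets are compact saturated, a strong R-space is an R-space.\<close>

lemma spec_le_iff_openin: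
  "spec_le X x y \<longleftrightarrow>
     x \<in> topspace X \<and> y \<in> topspace X \<and> (\<forall>U. openin X U \<and> x \<in> U \<longrightarrow> y \<in> U)"
  by (auto simp: spec_le_def in_closure_of)

text \<open>Open sets are upper sets for the specialization order. This lets open neighbourhoods and
  covers pass between \<open>A\<close> and \<open>up_set X A\<close>.\<close>

lemma up_set_subset_openin_iff:
  assumes "A \<subseteq> topspace X" "openin X U"
  shows "up_set X A \<subseteq> U \<longleftrightarrow> A \<subseteq> U"
  using assms unfolding up_set_def spec_le_iff_openin by blast

lemma saturatedin_up_set:
  assumes "A \<subseteq> topspace X"
  shows "saturatedin X (up_set X A)"
proof -
  have "y \<in> up_set X A" if y: "y \<in> \<Inter>{U. openin X U \<and> up_set X A \<subseteq> U}" for y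
  proof (rule ccontr)
    assume "y \<notin> up_set X A"
    moreover have "y \<in> topspace X"
      using y by (auto simp: up_set_def)
    ultimately have "\<forall>x\<in>A. \<exists>U. openin X U \<and> x \<in> U \<and> y \<notin> U"
      using assms by (auto simp: up_set_def spec_le_iff_openin)
    \<comment> \<open>The union of all open sets missing \<open>y\<close> is itself an open set
      missing \<open>y\<close>. As it contains \<open>A\<close>, it contains
      \<open>up_set X A\<close>, so \<open>y\<close> would have to belong to it.\<close>
    then have "A \<subseteq> \<Union>{U. openin X U \<and> y \<notin> U}"
      by blast
    moreover have "openin X (\<Union>{U. openin X U \<and> y \<notin> U})"
      by auto
    ultimately show False
      using y up_set_subset_openin_iff[OF assms] by blast
  qed
  then show ?thesis
    by (auto simp: saturatedin_def up_set_def)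
qed

text \<open>A family of open sets covers \<open>up_set X A\<close> exactly when it covers
  \<open>A\<close>, since its union is open; hence a finite subcover of \<open>A\<close> also serves
  \<open>up_set X A\<close>.\<close>

lemma compactin_up_set:
  assumes "compactin X A"
  shows "compactin X (up_set X A)"
proof -
  have A: "A \<subseteq> topspace X"
    using assms by (rule compactin_subset_topspace)
  have "\<exists>\<V>. finite \<V> \<and> \<V> \<subseteq> \<U> \<and> up_set X A \<subseteq> \<Union>\<V>"
    if \<U>: "\<forall>U\<in>\<U>. openin X U" "up_set X A \<subseteq> \<Union>\<U>" for \<U>
  proof -
    have "A \<subseteq> \<Union>\<U>"
      using \<U> up_set_subset_openin_iff[OF A] by (metis openin_Union)
    then obtain \<V> where "finite \<V>" "\<V> \<subseteq> \<U>" "A \<subseteq> \<Union>\<V>"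
      using assms \<U>(1) unfolding compactin_def by meson
    then show ?thesis
      using \<U>(1) up_set_subset_openin_iff[OF A] by (metis openin_Union subsetD)
  qed
  then show ?thesis
    by (auto simp: compactin_def up_set_def)
qed

lemma subset_up_set: "A \<subseteq> topspace X \<Longrightarrow> A \<subseteq> up_set X A"
  by (auto simp: up_set_def spec_le_iff_openin)

lemma up_set_in_compact_saturated_sets:
  assumes "compactin X A" "A \<noteq> {}"
  shows "up_set X A \<in> compact_saturated_sets X"
  using assms compactin_up_set[of X A] saturatedin_up_set[of A X] subset_up_set[of A X]
    compactin_subset_topspace[of X A]
  by (auto simp: compact_saturated_sets_def)

lemma up_set_subset_saturatedin:
  assumes "saturatedin X S" "A \<subseteq> S"
  shows "up_set X A \<subseteq> S"
proof -
  have "up_set X A \<subseteq> \<Inter>{U. openin X U \<and> S \<subseteq> U}"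
    using assms(2) by (auto simp: up_set_def spec_le_iff_openin)
  then show ?thesis
    using assms(1) unfolding saturatedin_def by metis
qed

text \<open>The specialization order of the Smyth power space is reverse inclusion. Here
  \<open>smyth_box\<close> is applied to a set \<open>K\<close> that need not be open.\<close>

lemma up_set_smyth_power_singleton:
  assumes "K \<in> compact_saturated_sets X"
  shows "up_set (smyth_power X) {K} = smyth_box X K"
  using assms by (auto simp: up_set_def spec_le_smyth_power topspace_smyth_power smyth_box_def)

lemma strong_R_space_if_R_space_smyth_power:
  assumes "t0_space X" "R_space (smyth_power X)"
  shows "strong_R_space X"
  unfolding strong_R_space_def
proof (intro conjI allI impI)
  fix \<K> U
  assume "\<K> \<noteq> {} \<and> \<K> \<subseteq> compact_saturated_sets X \<and> openin X U \<and> \<Inter>\<K> \<subseteq> U"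
  then have "\<K> \<noteq> {}" and \<K>: "\<K> \<subseteq> compact_saturated_sets X" and "openin X U" "\<Inter>\<K> \<subseteq> U"
    by auto
  let ?\<F> = "(\<lambda>K. {K}) ` \<K>"
  have box: "up_set (smyth_power X) {K} = smyth_box X K" if "K \<in> \<K>" for K
    using subsetD[OF \<K> that] by (rule up_set_smyth_power_singleton)
  have "(\<Inter>F\<in>?\<F>. up_set (smyth_power X) F) = (\<Inter>K\<in>\<K>. smyth_box X K)"
    by (simp add: box)
  \<comment> \<open>A set lying in every box is contained in \<open>\<Inter>\<K>\<close>, hence in
    \<open>U\<close>; since \<open>\<K>\<close> is nonempty, it is also compact saturated.\<close>
  also have "\<dots> \<subseteq> smyth_box X U"
    using \<open>\<K> \<noteq> {}\<close> \<open>\<Inter>\<K> \<subseteq> U\<close> unfolding smyth_box_def by blast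
  finally have "(\<Inter>F\<in>?\<F>. up_set (smyth_power X) F) \<subseteq> smyth_box X U" .
  moreover have "?\<F> \<noteq> {}" "\<forall>F\<in>?\<F>. F \<noteq> {} \<and> finite F \<and> F \<subseteq> topspace (smyth_power X)"
    using \<open>\<K> \<noteq> {}\<close> \<K> by (auto simp: topspace_smyth_power)
  moreover have "openin (smyth_power X) (smyth_box X U)"
    using \<open>openin X U\<close> by (rule openin_smyth_box)
  ultimately obtain \<G> where \<G>: "\<G> \<subseteq> ?\<F>" "finite \<G>" "\<G> \<noteq> {}"
    "(\<Inter>F\<in>\<G>. up_set (smyth_power X) F) \<subseteq> smyth_box X U"
    using assms(2) unfolding R_space_def by meson
  then obtain \<J> where \<J>: "\<J> \<subseteq> \<K>" "finite \<J>" "\<G> = (\<lambda>K. {K}) ` \<J>"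
    by (meson finite_subset_image)
  have "x \<in> U" if x: "x \<in> \<Inter>\<J>" for x
  proof -
    have sat: "saturatedin X K" if "K \<in> \<J>" for K
      using that \<J>(1) \<K> by (auto simp: compact_saturated_sets_def)
    \<comment> \<open>\<open>\<J>\<close> is nonempty because \<open>\<G>\<close> is, so
      \<open>x\<close> lies in some saturated set and therefore in the space.\<close>
    have "x \<in> topspace X"
      using x sat \<G>(3) \<J>(3) by (auto simp: saturatedin_def)
    then have "up_set X {x} \<in> compact_saturated_sets X" "x \<in> up_set X {x}"
      using subset_up_set[of "{x}" X] by (auto intro!: up_set_in_compact_saturated_sets)
    moreover have "up_set X {x} \<subseteq> K" if "K \<in> \<J>" for K
      using that x sat by (intro up_set_subset_saturatedin) auto
    ultimately have "up_set X {x} \<in> smyth_box X K" if "K \<in> \<J>" for K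
      using that by (simp add: smyth_box_def)
    \<comment> \<open>The choice of \<open>\<G>\<close> now puts \<open>up_set X {x}\<close> into
      \<open>smyth_box X U\<close>, so its element \<open>x\<close> lies in
      \<open>U\<close>.\<close>
    then have "up_set X {x} \<in> (\<Inter>F\<in>\<G>. up_set (smyth_power X) F)"
      using \<J> box by auto
    then show ?thesis
      using \<G>(4) \<open>x \<in> up_set X {x}\<close> by (auto simp: smyth_box_def)
  qed
  then show "\<exists>\<J>\<subseteq>\<K>. finite \<J> \<and> \<J> \<noteq> {} \<and> \<Inter>\<J> \<subseteq> U"
    using \<J> \<G>(3) by blast
qed (fact assms(1))

lemma R_space_if_strong_R_space:
  assumes "strong_R_space X"
  shows "R_space X"
  unfolding R_space_def
proof (intro conjI allI impI)
  show "t0_space X"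
    using assms by (simp add: strong_R_space_def)
next
  fix \<F> U
  assume *: "\<F> \<noteq> {} \<and> (\<forall>F\<in>\<F>. F \<noteq> {} \<and> finite F \<and> F \<subseteq> topspace X) \<and> openin X U \<and>
    (\<Inter>F\<in>\<F>. up_set X F) \<subseteq> U"
  have "up_set X ` \<F> \<subseteq> compact_saturated_sets X"
    using * by (auto intro!: up_set_in_compact_saturated_sets finite_imp_compactin)
  then obtain \<J> where \<J>: "\<J> \<subseteq> up_set X ` \<F>" "finite \<J>" "\<J> \<noteq> {}" "\<Inter>\<J> \<subseteq> U"
    using * assms unfolding strong_R_space_def by (metis image_is_empty)
  \<comment> \<open>Different members of \<open>\<F>\<close> may have the same upper set; one
    preimage for each member of \<open>\<J>\<close> suffices, which keeps \<open>\<G>\<close>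
    finite.\<close>
  then obtain \<G> where "\<G> \<subseteq> \<F>" "finite \<G>" "\<J> = up_set X ` \<G>"
    by (meson finite_subset_image)
  then show "\<exists>\<G>\<subseteq>\<F>. finite \<G> \<and> \<G> \<noteq> {} \<and> (\<Inter>F\<in>\<G>. up_set X F) \<subseteq> U"
    using \<J> by blast
qed

theorem proposition6p1:
  fixes X :: "'a topology"
  assumes "t0_space X"
    and "R_space (smyth_power X)"
  shows "strong_R_space X \<and> R_space X"
  using strong_R_space_if_R_space_smyth_power[OF assms] R_space_if_strong_R_space by blast

end
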